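(* Let $m$ be a positive integer and let $q\ge1$ be such that there is a constant $C_{q,m}\ge1$ with $$\left(\sum_{|\alpha|=m}|\varepsilon_\alpha|^{q}\right)^{\frac1q}\le C_{q,m}\,\|P_{m,n}\|$$ for every positive integer $n$ and every $m$-homogeneous Bernoulli polynomial $P_{m,n}:\ell_\infty^n\to\mathbb{C}$, $$P_{m,n}(z)=\sum_{|\alpha|=m}\varepsilon_\alpha z^\alpha .$$ Then $$q\ge\frac{2m}{m+1}.$$
   Context: $\ell_\infty^n$ is $\mathbb{C}^n$ with the sup norm and $\|P\|=\sup\{|P(z)|:\|z\|_\infty\le1\}$. For a multi-index $\alpha=(\alpha_1,\ldots,\alpha_n)$ of nonnegative integers, $|\alpha|=\alpha_1+\cdots+\alpha_n$ and $z^\alpha=z_1^{\alpha_1}\cdots z_n^{\alpha_n}$. An $m$-homogeneous Bernoulli polynomial is a polynomial $\sum_{|\alpha|=m}\varepsilon_\alpha z^\alpha$ (sum over all multi-indices with $|\alpha|=m$) all of whose coefficients satisfy $\varepsilon_\alpha\in\{-1,1\}$. *)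

theory Defs
  imports "HOL-Analysis.Analysis"
begin

text \<open>The dimension \<open>n\<close> is quantified inside the theorem, so a vector of $\mathbb{C}^n$ is
  a function \<open>nat \<Rightarrow> complex\<close> and a multi-index a function \<open>nat \<Rightarrow> nat\<close>, with
  coordinates \<open>0, \<dots>, n - 1\<close> and value \<open>0\<close> beyond them, so that each vector and each
  multi-index has a unique representative.\<close>

definition Cspace :: "nat \<Rightarrow> (nat \<Rightarrow> complex) set" where
  "Cspace n = {z. \<forall>i\<ge>n. z i = 0}"

text \<open>Only meaningful for \<open>n > 0\<close>, as \<open>Max\<close> of the empty set is unspecified.\<close>

definition sup_norm :: "nat \<Rightarrow> (nat \<Rightarrow> complex) \<Rightarrow> real" where
  "sup_norm n z = (MAX i\<in>{..<n}. cmod (z i))"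

lemma sup_norm_le_iff:
  assumes "n > 0"
  shows "sup_norm n z \<le> r \<longleftrightarrow> (\<forall>i<n. cmod (z i) \<le> r)"
  using assms unfolding sup_norm_def by (subst Max_le_iff) auto

definition multi_indices :: "nat \<Rightarrow> nat \<Rightarrow> (nat \<Rightarrow> nat) set" where
  "multi_indices n m = {\<alpha>. (\<forall>i\<ge>n. \<alpha> i = 0) \<and> (\<Sum>i<n. \<alpha> i) = m}"

definition hom_poly ::
  "nat \<Rightarrow> nat \<Rightarrow> ((nat \<Rightarrow> nat) \<Rightarrow> complex) \<Rightarrow> (nat \<Rightarrow> complex) \<Rightarrow> complex" where
  "hom_poly n m \<epsilon> z = (\<Sum>\<alpha>\<in>multi_indices n m. \<epsilon> \<alpha> * (\<Prod>i<n. z i ^ \<alpha> i))"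

definition bernoulli_coeffs :: "nat \<Rightarrow> nat \<Rightarrow> ((nat \<Rightarrow> nat) \<Rightarrow> complex) \<Rightarrow> bool" where
  "bernoulli_coeffs n m \<epsilon> \<longleftrightarrow> (\<forall>\<alpha>\<in>multi_indices n m. \<epsilon> \<alpha> \<in> {-1, 1})"

definition poly_norm :: "nat \<Rightarrow> ((nat \<Rightarrow> complex) \<Rightarrow> complex) \<Rightarrow> real" where
  "poly_norm n P = (SUP z\<in>{z \<in> Cspace n. sup_norm n z \<le> 1}. cmod (P z))"

lemma finite_multi_indices: "finite (multi_indices n m)"
proof (rule finite_subset)
  show "multi_indices n m \<subseteq>
      {\<alpha>. \<forall>i. (i \<in> {..<n} \<longrightarrow> \<alpha> i \<in> {..m}) \<and> (i \<notin> {..<n} \<longrightarrow> \<alpha> i = 0)}"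
    unfolding multi_indices_def by (auto intro: member_le_sum)
  show "finite {\<alpha>. \<forall>i. (i \<in> {..<n} \<longrightarrow> \<alpha> i \<in> {..m}) \<and> (i \<notin> {..<n} \<longrightarrow> \<alpha> i = (0::nat))}"
    by (rule finite_set_of_finite_funs) auto
qed

text \<open>The supremum in \<open>poly_norm\<close> is that of a nonempty set bounded above, hence a genuine one.\<close>

lemma zero_in_unit_ball:
  assumes "n > 0"
  shows "(\<lambda>_. 0) \<in> {z \<in> Cspace n. sup_norm n z \<le> 1}"
  using assms by (simp add: Cspace_def sup_norm_le_iff)

lemma bdd_above_hom_poly:
  assumes "n > 0"
  shows "bdd_above ((\<lambda>z. cmod (hom_poly n m \<epsilon> z)) ` {z \<in> Cspace n. sup_norm n z \<le> 1})"
proof (rule bdd_aboveI2)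
  fix z assume "z \<in> {z \<in> Cspace n. sup_norm n z \<le> 1}"
  then have "cmod (z i) \<le> 1" if "i < n" for i
    using that assms by (simp add: sup_norm_le_iff)
  then have "cmod (\<Prod>i<n. z i ^ \<alpha> i) \<le> 1" for \<alpha>
    by (auto simp: prod_norm[symmetric] norm_power intro!: prod_le_1 power_le_one)
  then show "cmod (hom_poly n m \<epsilon> z) \<le> (\<Sum>\<alpha>\<in>multi_indices n m. cmod (\<epsilon> \<alpha>))"
    unfolding hom_poly_def
    by (intro sum_norm_le) (simp add: norm_mult mult_left_le)
qed

end

theory Submission
  imports Defs
begin

text \<open>A Bernoulli polynomial has of the order of \<open>n\<^sup>m\<close> coefficients, all of modulus one, so the left-hand
  side of the hypothesis is of order \<open>n powr (m / q)\<close>. It therefore suffices to find, for arbitrarily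
  large \<open>n\<close>, signs for which the norm of the polynomial is of order \<open>n powr ((m + 1) / 2)\<close>: comparing
  exponents then gives \<open>m / q \<le> (m + 1) / 2\<close>, which is the claim. Such signs are usually produced at
  random (Kahane--Salem--Zygmund); the proof below writes them down.

  Let \<open>n = 2 ^ k\<close>, let \<open>W\<close> be the Walsh--Hadamard matrix of order \<open>n\<close> and \<open>U\<close> its part on and above
  the diagonal. A monomial of degree \<open>m\<close> is the same thing as a nondecreasing word
  \<open>i\<^sub>1 \<le> \<dots> \<le> i\<^sub>m\<close> of indices (\<open>bij_betw_count_sorted_words\<close>), and it gets the coefficient
  \<open>W i\<^sub>1 i\<^sub>2 * W i\<^sub>2 i\<^sub>3 * \<dots>\<close>. The restriction to nondecreasing words turns each \<open>W\<close> into \<open>U\<close>, so that,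
  with \<open>D\<close> the diagonal matrix of \<open>z\<close> and \<open>1\<close> the all-ones vector, the polynomial is the matrix
  product \<open>1\<^sup>T D U D U \<dots> U z\<close> with \<open>m - 1\<close> factors \<open>U\<close> (\<open>sum_path_sign\<close>). For \<open>z\<close> in the unit ball
  of the sup norm, \<open>D\<close> is a contraction for the Euclidean norm, the two outer vectors have norm at
  most \<open>sqrt n\<close>, and the polynomial is at most \<open>n * (norm of U) ^ (m - 1)\<close>.

  It remains to see that \<open>U\<close> has operator norm of order \<open>sqrt n\<close>, as \<open>W\<close> has. Triangular truncation
  may cost a logarithm in general, but the block form of \<open>W\<close> avoids it: the upper right block of \<open>U\<close>
  is a full Walsh matrix, the two diagonal blocks are copies of the previous \<open>U\<close> up to sign, and so
  the norm grows like a geometric sum of ratio \<open>sqrt 2\<close>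
  (\<open>l2_norm_upper_walsh_apply_le\<close>).\<close>

section \<open>The triangular part of a Walsh matrix\<close>

text \<open>The Sylvester form of the Hadamard matrix of order \<open>2 ^ k\<close>: four copies of the matrix of order
  \<open>2 ^ (k - 1)\<close>, the lower right one negated.\<close>

fun walsh :: "nat \<Rightarrow> nat \<Rightarrow> nat \<Rightarrow> complex" where
  "walsh 0 i j = 1"
| "walsh (Suc k) i j =
     (if 2 ^ k \<le> i \<and> 2 ^ k \<le> j then -1 else 1) * walsh k (i mod 2 ^ k) (j mod 2 ^ k)"

definition walsh_apply :: "nat \<Rightarrow> (nat \<Rightarrow> complex) \<Rightarrow> nat \<Rightarrow> complex" where
  "walsh_apply k x i = (\<Sum>j<2 ^ k. walsh k i j * x j)"

definition upper_walsh_apply :: "nat \<Rightarrow> (nat \<Rightarrow> complex) \<Rightarrow> nat \<Rightarrow> complex" where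
  "upper_walsh_apply k x i = (\<Sum>j<2 ^ k. if i \<le> j then walsh k i j * x j else 0)"

definition l2_norm :: "nat \<Rightarrow> (nat \<Rightarrow> complex) \<Rightarrow> real" where
  "l2_norm n x = L2_set (\<lambda>i. cmod (x i)) {..<n}"

lemma walsh_sign: "walsh k i j \<in> {-1, 1}"
  by (induction k i j rule: walsh.induct) auto

lemma sum_lessThan_add:
  fixes f :: "nat \<Rightarrow> 'a::comm_monoid_add"
  shows "(\<Sum>j<a + b. f j) = (\<Sum>j<a. f j) + (\<Sum>j<b. f (a + j))"
  by (induction b) (simp_all add: add.assoc)

lemma sum_lessThan_pow2_Suc:
  fixes f :: "nat \<Rightarrow> 'a::comm_monoid_add"
  shows "(\<Sum>j<2 ^ Suc k. f j) = (\<Sum>j<2 ^ k. f j) + (\<Sum>j<2 ^ k. f (2 ^ k + j))"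
  by (simp add: mult_2 sum_lessThan_add)

lemma l2_norm_nonneg: "0 \<le> l2_norm n x"
  by (simp add: l2_norm_def)

lemma l2_norm_power2: "(l2_norm n x)\<^sup>2 = (\<Sum>i<n. (cmod (x i))\<^sup>2)"
  by (simp add: l2_norm_def L2_set_def sum_nonneg)

lemma l2_norm_pow2_Suc_power2:
  "(l2_norm (2 ^ Suc k) x)\<^sup>2 = (l2_norm (2 ^ k) x)\<^sup>2 + (l2_norm (2 ^ k) (\<lambda>i. x (2 ^ k + i)))\<^sup>2"
  by (simp only: l2_norm_power2 sum_lessThan_pow2_Suc)

lemma l2_norm_cong: "(\<And>i. i < n \<Longrightarrow> x i = y i) \<Longrightarrow> l2_norm n x = l2_norm n y"
  unfolding l2_norm_def by (intro L2_set_cong) auto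

lemma l2_norm_triangle: "l2_norm n (\<lambda>i. x i + y i) \<le> l2_norm n x + l2_norm n y"
proof -
  have "l2_norm n (\<lambda>i. x i + y i) \<le> L2_set (\<lambda>i. cmod (x i) + cmod (y i)) {..<n}"
    unfolding l2_norm_def by (intro L2_set_mono) (auto intro: norm_triangle_ineq)
  also have "\<dots> \<le> l2_norm n x + l2_norm n y"
    unfolding l2_norm_def by (rule L2_set_triangle_ineq)
  finally show ?thesis .
qed

lemma l2_norm_mult_le:
  assumes "\<And>i. i < n \<Longrightarrow> cmod (z i) \<le> 1"
  shows "l2_norm n (\<lambda>i. z i * x i) \<le> l2_norm n x"
  unfolding l2_norm_def
  by (intro L2_set_mono) (auto simp: norm_mult assms intro!: mult_left_le_one_le)

lemma walsh_apply_Suc: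
  assumes "i < 2 ^ k"
  shows "walsh_apply (Suc k) x i = walsh_apply k x i + walsh_apply k (\<lambda>j. x (2 ^ k + j)) i"
    and "walsh_apply (Suc k) x (2 ^ k + i) =
           walsh_apply k x i - walsh_apply k (\<lambda>j. x (2 ^ k + j)) i"
  using assms unfolding walsh_apply_def sum_lessThan_pow2_Suc
  by (simp_all add: sum_negf)

text \<open>The block form of the triangular part: its upper right block lies entirely above the diagonal
  and is not truncated, its lower left block vanishes.\<close>

lemma upper_walsh_apply_Suc:
  assumes "i < 2 ^ k"
  shows "upper_walsh_apply (Suc k) x i =
           upper_walsh_apply k x i + walsh_apply k (\<lambda>j. x (2 ^ k + j)) i"
    and "upper_walsh_apply (Suc k) x (2 ^ k + i) =
           - upper_walsh_apply k (\<lambda>j. x (2 ^ k + j)) i"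
proof -
  show "upper_walsh_apply (Suc k) x i =
           upper_walsh_apply k x i + walsh_apply k (\<lambda>j. x (2 ^ k + j)) i"
    using assms unfolding upper_walsh_apply_def walsh_apply_def sum_lessThan_pow2_Suc
    by (intro arg_cong2[of _ _ _ _ "(+)"] sum.cong) auto
  have "(\<Sum>j<2 ^ k. if 2 ^ k + i \<le> j then walsh (Suc k) (2 ^ k + i) j * x j else 0) = 0"
    by (intro sum.neutral) auto
  then show "upper_walsh_apply (Suc k) x (2 ^ k + i) =
           - upper_walsh_apply k (\<lambda>j. x (2 ^ k + j)) i"
    using assms unfolding upper_walsh_apply_def sum_lessThan_pow2_Suc
    by (simp add: sum_negf[symmetric]) (intro sum.cong, auto)
qed

lemma cmod_parallelogram:
  "(cmod (a + b))\<^sup>2 + (cmod (a - b))\<^sup>2 = 2 * (cmod a)\<^sup>2 + 2 * (cmod b)\<^sup>2"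
  unfolding cmod_power2 by (simp add: power2_eq_square algebra_simps)

text \<open>A Walsh matrix is \<open>2 ^ (k / 2)\<close> times an isometry: on the two halves of a vector the block form
  is the map \<open>(a, b) \<mapsto> (a + b, a - b)\<close>, which doubles the squared norm.\<close>

lemma l2_norm_walsh_apply_power2:
  "(l2_norm (2 ^ k) (walsh_apply k x))\<^sup>2 = 2 ^ k * (l2_norm (2 ^ k) x)\<^sup>2"
proof (induction k arbitrary: x)
  case 0
  show ?case by (simp add: l2_norm_power2 walsh_apply_def)
next
  case (Suc k)
  let ?hi = "\<lambda>j. x (2 ^ k + j)"
  have "(l2_norm (2 ^ Suc k) (walsh_apply (Suc k) x))\<^sup>2 =
      (\<Sum>i<2 ^ k. (cmod (walsh_apply k x i + walsh_apply k ?hi i))\<^sup>2) +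
      (\<Sum>i<2 ^ k. (cmod (walsh_apply k x i - walsh_apply k ?hi i))\<^sup>2)"
    unfolding l2_norm_power2 sum_lessThan_pow2_Suc by (simp add: walsh_apply_Suc)
  also have "\<dots> = 2 * (l2_norm (2 ^ k) (walsh_apply k x))\<^sup>2 +
      2 * (l2_norm (2 ^ k) (walsh_apply k ?hi))\<^sup>2"
    unfolding l2_norm_power2 sum.distrib[symmetric] cmod_parallelogram
    by (simp add: sum.distrib sum_distrib_left)
  also have "\<dots> = 2 ^ Suc k * (l2_norm (2 ^ Suc k) x)\<^sup>2"
    unfolding Suc.IH l2_norm_pow2_Suc_power2 by (simp add: algebra_simps)
  finally show ?case .
qed

lemma l2_norm_walsh_apply: "l2_norm (2 ^ k) (walsh_apply k x) = sqrt 2 ^ k * l2_norm (2 ^ k) x"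
proof (rule power2_eq_imp_eq)
  show "(l2_norm (2 ^ k) (walsh_apply k x))\<^sup>2 = (sqrt 2 ^ k * l2_norm (2 ^ k) x)\<^sup>2"
    by (simp add: l2_norm_walsh_apply_power2 power_mult_distrib power_mult[symmetric]
        mult.commute[of k 2]) (simp add: power_mult)
qed (simp_all add: l2_norm_nonneg)

text \<open>By the block form, the triangular part of order \<open>2 ^ Suc k\<close> is the sum of a block diagonal matrix,
  whose norm is that of the triangular part of order \<open>2 ^ k\<close>, and of a Walsh matrix of norm
  \<open>sqrt 2 ^ k\<close> that sends the second half of a vector to the first. The factor \<open>c = 1 + sqrt 2\<close> is the solution of
  \<open>c + 1 = c * sqrt 2\<close>, which makes the induction close.\<close>

lemma l2_norm_upper_walsh_apply_le:
  "l2_norm (2 ^ k) (upper_walsh_apply k x) \<le> (1 + sqrt 2) * sqrt 2 ^ k * l2_norm (2 ^ k) x"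
proof (induction k arbitrary: x)
  case 0
  have "upper_walsh_apply 0 x i = x i" if "i < 1" for i
    using that by (simp add: upper_walsh_apply_def)
  then have "l2_norm 1 (upper_walsh_apply 0 x) = l2_norm 1 x"
    by (rule l2_norm_cong)
  then show ?case
    using mult_right_mono[of 1 "1 + sqrt 2" "l2_norm 1 x"] by (simp add: l2_norm_nonneg)
next
  case (Suc k)
  let ?n = "2 ^ k :: nat"
  let ?c = "(1 + sqrt 2) * sqrt 2 ^ k"
  let ?hi = "\<lambda>j. x (?n + j)"
  \<comment> \<open>\<open>d\<close> is the contribution of the two diagonal blocks, \<open>e\<close> that of the upper right block.\<close>
  define d where "d = (\<lambda>i. if i < ?n then upper_walsh_apply k x i
                           else - upper_walsh_apply k ?hi (i - ?n))"
  define e where "e = (\<lambda>i. if i < ?n then walsh_apply k ?hi i else 0)"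
  have split: "upper_walsh_apply (Suc k) x i = d i + e i" if "i < 2 ^ Suc k" for i
  proof (cases "i < ?n")
    case True
    then show ?thesis by (simp add: d_def e_def upper_walsh_apply_Suc)
  next
    case False
    then have "i - ?n < ?n" "i = ?n + (i - ?n)" using that by auto
    then show ?thesis
      using False upper_walsh_apply_Suc(2)[of "i - ?n" k x] by (simp add: d_def e_def)
  qed
  have "(l2_norm (2 ^ Suc k) d)\<^sup>2 =
      (l2_norm ?n (upper_walsh_apply k x))\<^sup>2 + (l2_norm ?n (upper_walsh_apply k ?hi))\<^sup>2"
    unfolding l2_norm_pow2_Suc_power2 by (simp add: l2_norm_power2 d_def)
  also have "\<dots> \<le> (?c * l2_norm ?n x)\<^sup>2 + (?c * l2_norm ?n ?hi)\<^sup>2"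
    by (intro add_mono power_mono Suc.IH l2_norm_nonneg)
  also have "\<dots> = (?c * l2_norm (2 ^ Suc k) x)\<^sup>2"
    unfolding power_mult_distrib l2_norm_pow2_Suc_power2 by (simp add: algebra_simps)
  finally have d: "l2_norm (2 ^ Suc k) d \<le> ?c * l2_norm (2 ^ Suc k) x"
    by (rule power2_le_imp_le) (simp add: l2_norm_nonneg)
  have "(l2_norm (2 ^ Suc k) e)\<^sup>2 = (l2_norm ?n (walsh_apply k ?hi))\<^sup>2"
    unfolding l2_norm_pow2_Suc_power2 by (simp add: l2_norm_power2 e_def)
  also have "\<dots> = (sqrt 2 ^ k)\<^sup>2 * (l2_norm ?n ?hi)\<^sup>2"
    by (simp add: l2_norm_walsh_apply power_mult_distrib)
  also have "\<dots> \<le> (sqrt 2 ^ k)\<^sup>2 * (l2_norm (2 ^ Suc k) x)\<^sup>2"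
    unfolding l2_norm_pow2_Suc_power2 by (intro mult_left_mono) auto
  finally have "(l2_norm (2 ^ Suc k) e)\<^sup>2 \<le> (sqrt 2 ^ k * l2_norm (2 ^ Suc k) x)\<^sup>2"
    by (simp add: power_mult_distrib)
  then have e: "l2_norm (2 ^ Suc k) e \<le> sqrt 2 ^ k * l2_norm (2 ^ Suc k) x"
    by (rule power2_le_imp_le) (simp add: l2_norm_nonneg)
  have "l2_norm (2 ^ Suc k) (upper_walsh_apply (Suc k) x) = l2_norm (2 ^ Suc k) (\<lambda>i. d i + e i)"
    by (intro l2_norm_cong split)
  also have "\<dots> \<le> (?c + sqrt 2 ^ k) * l2_norm (2 ^ Suc k) x"
    using l2_norm_triangle[of "2 ^ Suc k" d e] d e by (simp add: algebra_simps)
  also have "?c + sqrt 2 ^ k = (1 + sqrt 2) * sqrt 2 ^ Suc k"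
    by (simp add: algebra_simps)
  finally show ?case .
qed

section \<open>Nondecreasing words and multi-indices\<close>

text \<open>The lower bound \<open>i\<close> on the letters makes the set recursive: a word continues, after its first
  letter \<open>l\<close>, as a word with lower bound \<open>l\<close>.\<close>

definition sorted_words :: "nat \<Rightarrow> nat \<Rightarrow> nat \<Rightarrow> nat list set" where
  "sorted_words n m i = {xs. length xs = m \<and> sorted xs \<and> set xs \<subseteq> {i..<n}}"

lemma finite_sorted_words: "finite (sorted_words n m i)"
  by (rule finite_subset[OF _ finite_lists_length_eq[of "{i..<n}" m]])
    (auto simp: sorted_words_def)

lemma sorted_words_Suc:
  "sorted_words n (Suc m) i = (\<lambda>(l, xs). l # xs) ` (SIGMA l:{i..<n}. sorted_words n m l)"
proof (intro equalityI subsetI)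
  fix ys assume "ys \<in> sorted_words n (Suc m) i"
  then show "ys \<in> (\<lambda>(l, xs). l # xs) ` (SIGMA l:{i..<n}. sorted_words n m l)"
    by (cases ys) (auto simp: sorted_words_def image_iff)
next
  fix ys assume "ys \<in> (\<lambda>(l, xs). l # xs) ` (SIGMA l:{i..<n}. sorted_words n m l)"
  then show "ys \<in> sorted_words n (Suc m) i"
    by (fastforce simp: sorted_words_def)
qed

lemma sum_sorted_words_Suc:
  fixes f :: "nat list \<Rightarrow> 'a::comm_monoid_add"
  shows "(\<Sum>ys\<in>sorted_words n (Suc m) i. f ys) =
    (\<Sum>l\<in>{i..<n}. \<Sum>xs\<in>sorted_words n m l. f (l # xs))"
proof -
  have "inj_on (\<lambda>(l, xs). l # xs) (SIGMA l:{i..<n}. sorted_words n m l)"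
    by (auto simp: inj_on_def)
  then show ?thesis
    by (simp add: sorted_words_Suc sum.reindex sum.Sigma finite_sorted_words split_def)
qed

text \<open>Both sides encode multisets of size \<open>m\<close> over the first \<open>n\<close> numbers: a word lists the multiset in
  order, a multi-index is its multiplicity function.\<close>

lemma bij_betw_count_sorted_words:
  "bij_betw (\<lambda>xs. count (mset xs)) (sorted_words n m 0) (multi_indices n m)"
  unfolding bij_betw_def
proof (intro conjI equalityI subsetI)
  show "inj_on (\<lambda>xs. count (mset xs)) (sorted_words n m 0)"
    by (metis (mono_tags, lifting) count_inject inj_onI mem_Collect_eq properties_for_sort
        sorted_words_def)
next
  fix \<alpha> assume "\<alpha> \<in> (\<lambda>xs. count (mset xs)) ` sorted_words n m 0"
  then obtain xs where xs: "\<alpha> = count (mset xs)" "length xs = m" "set xs \<subseteq> {..<n}"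
    by (fastforce simp: sorted_words_def)
  have "(\<Sum>i<n. count (mset xs) i) = (\<Sum>i\<in>set xs. count (mset xs) i)"
    using xs by (intro sum.mono_neutral_right) (auto simp: not_in_iff[symmetric])
  also have "\<dots> = length xs"
    using size_multiset_overloaded_eq[of "mset xs"] by simp
  finally show "\<alpha> \<in> multi_indices n m"
    using xs by (fastforce simp: multi_indices_def not_in_iff[symmetric])
next
  fix \<alpha> assume \<alpha>: "\<alpha> \<in> multi_indices n m"
  define M where "M = (\<Sum>i<n. replicate_mset (\<alpha> i) i)"
  have M: "count M = \<alpha>"
    using \<alpha> by (auto simp: M_def multi_indices_def count_sum fun_eq_iff not_less)
  have "size M = m"
    using \<alpha> by (simp add: M_def multi_indices_def)
  moreover have "set_mset M \<subseteq> {..<n}"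
    by (auto simp: M_def set_mset_sum)
  ultimately have "sorted_list_of_multiset M \<in> sorted_words n m 0"
    by (auto simp: sorted_words_def simp flip: size_mset)
  moreover have "\<alpha> = count (mset (sorted_list_of_multiset M))"
    by (simp add: M)
  ultimately show "\<alpha> \<in> (\<lambda>xs. count (mset xs)) ` sorted_words n m 0"
    by (rule rev_image_eqI)
qed

lemma prod_power_count_mset:
  fixes z :: "nat \<Rightarrow> 'a::comm_monoid_mult"
  assumes "set xs \<subseteq> {..<n}"
  shows "(\<Prod>i<n. z i ^ count (mset xs) i) = prod_list (map z xs)"
  using assms
proof (induction xs)
  case (Cons x xs)
  have "(\<Prod>i<n. z i ^ count (mset (x # xs)) i) =
      (\<Prod>i<n. (if i = x then z i else 1) * z i ^ count (mset xs) i)"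
    by (intro prod.cong) auto
  also have "\<dots> = z x * prod_list (map z xs)"
    using Cons by (simp add: prod.distrib prod.delta')
  finally show ?case by simp
qed simp

text \<open>Stars and bars: there are \<open>(m + n - 1) choose m\<close> multi-indices,
  and \<open>N choose m\<close> is at least \<open>(N / m) ^ m\<close>.\<close>

lemma card_multi_indices_ge:
  assumes "n > 0" "m > 0"
  shows "(real n / real m) ^ m \<le> real (card (multi_indices n m))"
proof -
  let ?L = "{l :: nat list. length l = n \<and> sum_list l = m}"
  let ?f = "\<lambda>l i. if i < n then l ! i else (0::nat)"
  have "?f ` ?L \<subseteq> multi_indices n m"
    by (auto simp: multi_indices_def sum_list_sum_nth atLeast0LessThan)
  moreover have "inj_on ?f ?L"
    by (rule inj_onI) (auto simp: fun_eq_iff intro!: nth_equalityI split: if_splits; metis)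
  ultimately have "card ?L \<le> card (multi_indices n m)"
    using finite_multi_indices card_inj_on_le by blast
  then have "(m + n - 1) choose m \<le> card (multi_indices n m)"
    by (simp add: card_length_sum_list)
  moreover have "(real (m + n - 1) / real m) ^ m \<le> real ((m + n - 1) choose m)"
    using binomial_ge_n_over_k_pow_k[of m "m + n - 1", where 'a = real] assms by simp
  moreover have "(real n / real m) ^ m \<le> (real (m + n - 1) / real m) ^ m"
    using assms by (intro power_mono divide_right_mono) auto
  ultimately show ?thesis
    by linarith
qed

section \<open>A Bernoulli polynomial of small norm\<close>

fun path_sign :: "nat \<Rightarrow> nat list \<Rightarrow> complex" where
  "path_sign k (i # j # xs) = walsh k i j * path_sign k (j # xs)"
| "path_sign k xs = 1"

text \<open>The vector \<open>D U D U \<dots> D U z\<close> with \<open>m\<close> factors \<open>U\<close>, where \<open>U\<close> is the triangular part of the Walsh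
  matrix and \<open>D\<close> the diagonal matrix of \<open>z\<close>.\<close>

fun path_vector :: "nat \<Rightarrow> (nat \<Rightarrow> complex) \<Rightarrow> nat \<Rightarrow> nat \<Rightarrow> complex" where
  "path_vector k z 0 = z"
| "path_vector k z (Suc m) = (\<lambda>i. z i * upper_walsh_apply k (path_vector k z m) i)"

lemma path_sign_sign: "path_sign k xs \<in> {-1, 1}"
proof (induction k xs rule: path_sign.induct)
  case (1 k i j xs)
  then show ?case using walsh_sign[of k i j] by auto
qed auto

text \<open>Transfer matrix method: the signed monomials of degree \<open>m + 1\<close> whose smallest index is \<open>i\<close> are
  summed by splitting off that index. The next index runs over all \<open>l \<ge> i\<close>, which is one
  application of the triangular matrix.\<close>

lemma sum_path_sign:
  "(\<Sum>xs\<in>sorted_words (2 ^ k) m i. path_sign k (i # xs) * prod_list (map z (i # xs))) =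
    path_vector k z m i"
proof (induction m arbitrary: i)
  case 0
  have "sorted_words (2 ^ k) 0 i = {[]}" by (auto simp: sorted_words_def)
  then show ?case by simp
next
  case (Suc m)
  have "(\<Sum>xs\<in>sorted_words (2 ^ k) (Suc m) i. path_sign k (i # xs) * prod_list (map z (i # xs)))
      = (\<Sum>l\<in>{i..<2 ^ k}. \<Sum>xs\<in>sorted_words (2 ^ k) m l.
           z i * (walsh k i l * (path_sign k (l # xs) * prod_list (map z (l # xs)))))"
    by (simp add: sum_sorted_words_Suc mult_ac)
  also have "\<dots> = z i * (\<Sum>l\<in>{i..<2 ^ k}. walsh k i l * path_vector k z m l)"
    unfolding sum_distrib_left[symmetric] Suc.IH by simp
  also have "(\<Sum>l\<in>{i..<2 ^ k}. walsh k i l * path_vector k z m l) =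
      upper_walsh_apply k (path_vector k z m) i"
    unfolding upper_walsh_apply_def
    by (intro sum.mono_neutral_cong_left) auto
  finally show ?case by simp
qed

lemma l2_norm_le_sqrt:
  assumes "\<And>i. i < n \<Longrightarrow> cmod (z i) \<le> 1"
  shows "l2_norm n z \<le> sqrt n"
proof -
  have "(\<Sum>i<n. (cmod (z i))\<^sup>2) \<le> (\<Sum>i<n. 1)"
    using assms by (intro sum_mono) (auto intro: power_le_one)
  then show ?thesis by (simp add: l2_norm_def L2_set_def)
qed

lemma norm_sum_le_l2_norm: "cmod (\<Sum>i<n. x i) \<le> sqrt n * l2_norm n x"
proof -
  have "cmod (\<Sum>i<n. x i) \<le> (\<Sum>i<n. \<bar>1\<bar> * \<bar>cmod (x i)\<bar>)"
    by (simp add: sum_norm_le)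
  also have "\<dots> \<le> L2_set (\<lambda>_. 1) {..<n} * l2_norm n x"
    unfolding l2_norm_def by (rule L2_set_mult_ineq)
  finally show ?thesis by (simp add: L2_set_def)
qed

lemma l2_norm_path_vector_le:
  assumes "\<And>i. i < 2 ^ k \<Longrightarrow> cmod (z i) \<le> 1"
  shows "l2_norm (2 ^ k) (path_vector k z m) \<le> ((1 + sqrt 2) * sqrt 2 ^ k) ^ m * sqrt 2 ^ k"
proof (induction m)
  case 0
  show ?case using l2_norm_le_sqrt[of "2 ^ k" z, OF assms] by (simp add: real_sqrt_power)
next
  case (Suc m)
  have "l2_norm (2 ^ k) (path_vector k z (Suc m)) \<le>
      l2_norm (2 ^ k) (upper_walsh_apply k (path_vector k z m))"
    by (simp add: l2_norm_mult_le assms)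
  also have "\<dots> \<le> (1 + sqrt 2) * sqrt 2 ^ k * l2_norm (2 ^ k) (path_vector k z m)"
    by (rule l2_norm_upper_walsh_apply_le)
  also have "\<dots> \<le> (1 + sqrt 2) * sqrt 2 ^ k * (((1 + sqrt 2) * sqrt 2 ^ k) ^ m * sqrt 2 ^ k)"
    by (intro mult_left_mono Suc.IH) auto
  finally show ?case by (simp add: mult_ac)
qed

text \<open>For \<open>n = 2 ^ k\<close> the bound is \<open>(1 + sqrt 2) ^ m * n powr ((m + 1) / 2)\<close>: each of the \<open>m - 1\<close>
  applications of the triangular matrix costs a multiple of \<open>sqrt n\<close>, the norm of \<open>z\<close> costs another
  \<open>sqrt n\<close>, and so does the final summation over the smallest index.\<close>

lemma bernoulli_polynomial_small_norm:
  assumes "m > 0"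
  obtains \<epsilon> where "bernoulli_coeffs (2 ^ k) m \<epsilon>"
    and "poly_norm (2 ^ k) (hom_poly (2 ^ k) m \<epsilon>) \<le> (1 + sqrt 2) ^ m * sqrt 2 ^ (k * (m + 1))"
proof -
  let ?n = "2 ^ k :: nat"
  obtain r where r: "m = Suc r" using assms by (cases m) auto
  define w where "w = inv_into (sorted_words ?n m 0) (\<lambda>xs. count (mset xs))"
  define \<epsilon> where "\<epsilon> = (\<lambda>\<alpha>. path_sign k (w \<alpha>))"
  have w: "w (count (mset xs)) = xs" if "xs \<in> sorted_words ?n m 0" for xs
    unfolding w_def using that bij_betw_count_sorted_words
    by (intro inv_into_f_f) (auto simp: bij_betw_def)
  have poly: "hom_poly ?n m \<epsilon> z = (\<Sum>i<?n. path_vector k z r i)" for z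
  proof -
    have "hom_poly ?n m \<epsilon> z = (\<Sum>xs\<in>sorted_words ?n m 0.
        \<epsilon> (count (mset xs)) * (\<Prod>i<?n. z i ^ count (mset xs) i))"
      unfolding hom_poly_def
      by (rule sum.reindex_bij_betw[OF bij_betw_count_sorted_words, symmetric])
    also have "\<dots> = (\<Sum>xs\<in>sorted_words ?n m 0. path_sign k xs * prod_list (map z xs))"
      by (intro sum.cong) (auto simp: \<epsilon>_def w prod_power_count_mset sorted_words_def atLeast0LessThan)
    also have "\<dots> = (\<Sum>i<?n. path_vector k z r i)"
      unfolding r sum_sorted_words_Suc sum_path_sign by (simp add: atLeast0LessThan)
    finally show ?thesis .
  qed
  have bound: "cmod (hom_poly ?n m \<epsilon> z) \<le> (1 + sqrt 2) ^ m * sqrt 2 ^ (k * (m + 1))"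
    if "sup_norm ?n z \<le> 1" for z
  proof -
    have z: "cmod (z i) \<le> 1" if "i < ?n" for i
      using that \<open>sup_norm ?n z \<le> 1\<close> by (simp add: sup_norm_le_iff)
    have "cmod (hom_poly ?n m \<epsilon> z) \<le> sqrt 2 ^ k * l2_norm ?n (path_vector k z r)"
      using norm_sum_le_l2_norm[of "path_vector k z r" ?n] by (simp add: poly real_sqrt_power)
    also have "\<dots> \<le> sqrt 2 ^ k * (((1 + sqrt 2) * sqrt 2 ^ k) ^ r * sqrt 2 ^ k)"
      by (intro mult_left_mono l2_norm_path_vector_le z) auto
    also have "\<dots> = (1 + sqrt 2) ^ r * sqrt 2 ^ (k * (m + 1))"
      unfolding r power_mult_distrib power_mult[symmetric] by (simp add: power_add)
    also have "\<dots> \<le> (1 + sqrt 2) ^ m * sqrt 2 ^ (k * (m + 1))"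
      by (intro mult_right_mono power_increasing) (auto simp: r)
    finally show ?thesis .
  qed
  show thesis
  proof (rule that)
    show "bernoulli_coeffs ?n m \<epsilon>"
      using path_sign_sign by (auto simp: bernoulli_coeffs_def \<epsilon>_def)
    show "poly_norm ?n (hom_poly ?n m \<epsilon>) \<le> (1 + sqrt 2) ^ m * sqrt 2 ^ (k * (m + 1))"
      unfolding poly_norm_def using zero_in_unit_ball[of ?n] bound
      by (intro cSUP_least) auto
  qed
qed

theorem theorem10p3:
  fixes m :: nat and q :: real
  assumes "m > 0" and "q \<ge> 1"
    and "\<exists>C::real. C \<ge> 1 \<and> (\<forall>n::nat. \<forall>\<epsilon>. n > 0 \<longrightarrow> bernoulli_coeffs n m \<epsilon> \<longrightarrow>
           (\<Sum>\<alpha>\<in>multi_indices n m. cmod (\<epsilon> \<alpha>) powr q) powr (1 / q)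
             \<le> C * poly_norm n (hom_poly n m \<epsilon>))"
  shows "q \<ge> 2 * real m / (real m + 1)"
proof (rule ccontr)
  assume "\<not> ?thesis"
  then have "q * (real m + 1) < 2 * real m" by (simp add: field_simps)
  \<comment> \<open>The excess of the exponent of \<open>n\<close> on the left-hand side over that on the right-hand side.\<close>
  define d where "d = m / q - (real m + 1) / 2"
  have "d > 0"
    using \<open>q * (real m + 1) < 2 * real m\<close> \<open>q \<ge> 1\<close> by (simp add: d_def field_simps)
  obtain C where C: "C \<ge> 1" and CP: "\<And>n \<epsilon>. n > 0 \<Longrightarrow> bernoulli_coeffs n m \<epsilon> \<Longrightarrow>
      (\<Sum>\<alpha>\<in>multi_indices n m. cmod (\<epsilon> \<alpha>) powr q) powr (1 / q) \<le> C * poly_norm n (hom_poly n m \<epsilon>)"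
    using assms(3) by blast
  define K where "K = C * (1 + sqrt 2) ^ m * real m powr (m / q)"
  have bounded: "(2 powr d) ^ k \<le> K" for k
  proof -
    let ?n = "2 ^ k :: nat"
    obtain \<epsilon> where \<epsilon>: "bernoulli_coeffs ?n m \<epsilon>"
      "poly_norm ?n (hom_poly ?n m \<epsilon>) \<le> (1 + sqrt 2) ^ m * sqrt 2 ^ (k * (m + 1))"
      using bernoulli_polynomial_small_norm[OF \<open>m > 0\<close>] by blast
    have "cmod (\<epsilon> \<alpha>) = 1" if "\<alpha> \<in> multi_indices ?n m" for \<alpha>
      using that \<epsilon>(1) by (auto simp: bernoulli_coeffs_def)
    then have sum: "(\<Sum>\<alpha>\<in>multi_indices ?n m. cmod (\<epsilon> \<alpha>) powr q) = card (multi_indices ?n m)"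
      by simp
    have "(real ?n / m) powr (m / q) = ((real ?n / m) ^ m) powr (1 / q)"
      using \<open>m > 0\<close> by (simp add: powr_powr flip: powr_realpow)
    also have "\<dots> \<le> real (card (multi_indices ?n m)) powr (1 / q)"
      using card_multi_indices_ge[of ?n m] \<open>m > 0\<close> \<open>q \<ge> 1\<close> by (intro powr_mono2) auto
    also have "\<dots> \<le> C * poly_norm ?n (hom_poly ?n m \<epsilon>)"
      using CP[OF _ \<epsilon>(1)] by (simp add: sum)
    also have "\<dots> \<le> C * ((1 + sqrt 2) ^ m * sqrt 2 ^ (k * (m + 1)))"
      using \<epsilon>(2) C by (intro mult_left_mono) auto
    also have "sqrt 2 ^ (k * (m + 1)) = real ?n powr ((real m + 1) / 2)"
      by (simp add: powr_half_sqrt[symmetric] powr_powr flip: powr_realpow) (simp add: field_simps)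
    finally have "real ?n powr (m / q) \<le> K * real ?n powr ((real m + 1) / 2)"
      using \<open>m > 0\<close> by (simp add: K_def powr_divide field_simps)
    then have "real ?n powr d \<le> K"
      unfolding d_def powr_diff by (simp add: divide_le_eq)
    moreover have "real ?n powr d = (2 powr d) ^ k"
      by (simp add: powr_powr mult.commute flip: powr_realpow)
    ultimately show ?thesis by simp
  qed
  have "2 powr d > 1" using \<open>d > 0\<close> by simp
  then obtain k where "K < (2 powr d) ^ k" using real_arch_pow by blast
  with bounded[of k] show False by simp
qed

end
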